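(* Let $\mathcal{S},\mathcal{A}$ be finite state and action spaces, $K\ge 1$ an integer and $u\in(0,1)$. Let $(\mathbf{Q}^{(n)}_t)_{t\ge 0}$, $n=1,\dots,K$, be the $Q$-tables, $(\mathbf{w}^{(n)}_t)_{t\ge0}$ the weights, and $(\mathbf{Q}^{it}_t)_{t\ge0}$ the output $Q$-tables of the ESQL algorithm with constant update ratio $u_t=u$ (see context), so that $\mathbf{Q}^{it}_0=\mathbf{0}$ and $\mathbf{Q}^{it}_{t+1}=u\,\mathbf{Q}^{it}_t+(1-u)\sum_{n=1}^K\mathbf{w}^{(n)}_t\mathbf{Q}^{(n)}_t$. Define $$\Delta^{it}_t(s,a)=\mathbf{Q}^{it}_{t+1}(s,a)-\mathbf{Q}^{it}_t(s,a),\qquad \epsilon^{(n)}_t(s,a)=\mathbf{w}^{(n)}_{t+1}\mathbf{Q}^{(n)}_{t+1}(s,a)-\mathbf{w}^{(n)}_t\mathbf{Q}^{(n)}_t(s,a).$$ If there exist constants $\phi^{(n)}(s,a)\in(0,1)$ such that $$\frac{|\epsilon^{(n)}_{t+1}(s,a)|}{|\epsilon^{(n)}_t(s,a)|}\le\phi^{(n)}(s,a)\quad\text{for all } n\in\{1,\dots,K\},\ t\ge0,\ (s,a)\in\mathcal{S}\times\mathcal{A},$$ then $\lim_{t\to\infty}|\Delta^{it}_t(s,a)|=0$ for all $(s,a)\in\mathcal{S}\times\mathcal{A}$.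
   Context: ESQL (Ensemble Synthetic $Q$-Learning) runs, in parallel, $K$ $Q$-learning algorithms on $K$ finite Markov decision processes $\mathcal{M}^{(1)},\dots,\mathcal{M}^{(K)}$ sharing the same finite state space $\mathcal{S}$, finite action space $\mathcal{A}$, cost function and discount factor $\gamma\in(0,1)$. $\mathbf{Q}^{(n)}_t\in\mathbb{R}^{|\mathcal{S}|\times|\mathcal{A}|}$ is the $Q$-table of the $n$-th environment at time $t$. At each time $t$ the greedy policies $\boldsymbol{\pi}^{(n)}_t(s)=\operatorname{argmin}_{a'}\mathbf{Q}^{(n)}_t(s,a')$ are formed, the agreement rates $\frac1{|\mathcal{S}|}\sum_{j\in\mathcal{S}}\mathbf{1}(\boldsymbol{\pi}^{(1)}_t(j)=\boldsymbol{\pi}^{(n)}_t(j))$, $n=1,\dots,K$, are computed, and $(\mathbf{w}^{(1)}_t,\dots,\mathbf{w}^{(K)}_t)$ is the softmax of the vector of these rates (so the weights are positive and sum to $1$). Then $\mathbf{Q}^{it}_{t+1}=u_t\mathbf{Q}^{it}_t+(1-u_t)\sum_{n=1}^K\mathbf{w}^{(n)}_t\mathbf{Q}^{(n)}_t$ with $\mathbf{Q}^{it}_0=\mathbf{0}$. The statement is understood along each realization of the algorithm; the ratio condition presupposes that the denominators are nonzero. *)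

theory Defs
  imports "HOL-Probability.Probability"
begin

type_synonym ('s, 'a) qtable = "'s \<Rightarrow> 'a \<Rightarrow> real"

text \<open>
  The Markov decision processes share state space \<open>'s\<close>, action space \<open>'a\<close>, cost \<open>c\<close> and
  discount \<open>\<gamma>\<close>; an individual one is given by its transition kernel.

  The step size depends on the state-action pair and may be 0, which means that the pair is not
  updated. One step thus covers updating a single visited pair as well as updating several pairs, or
  all of them, at once. \<open>X s a\<close> is the next state sampled for the pair \<open>(s, a)\<close>.
\<close>

definition q_step ::
  "('s, 'a::finite) qtable \<Rightarrow> real \<Rightarrow> ('s, 'a) qtable \<Rightarrow> ('s \<Rightarrow> 'a \<Rightarrow> 's)
    \<Rightarrow> ('s, 'a) qtable \<Rightarrow> ('s, 'a) qtable" where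
  "q_step c \<gamma> \<alpha> X Q =
    (\<lambda>s a. (1 - \<alpha> s a) * Q s a + \<alpha> s a * (c s a + \<gamma> * (MIN a'. Q (X s a) a')))"

definition q_learning_run ::
  "('s \<Rightarrow> 'a \<Rightarrow> 's pmf) \<Rightarrow> ('s, 'a::finite) qtable \<Rightarrow> real \<Rightarrow> (nat \<Rightarrow> ('s, 'a) qtable) \<Rightarrow> bool" where
  "q_learning_run P c \<gamma> Q \<longleftrightarrow>
    (\<exists>\<alpha> X. \<forall>t. (\<forall>s a. \<alpha> t s a \<in> {0..1} \<and> X t s a \<in> set_pmf (P s a)) \<and>
      Q (Suc t) = q_step c \<gamma> (\<alpha> t) (X t) (Q t))"

text \<open>A relation, so that ties between minimizing actions may be broken in any way.\<close>

definition greedy :: "('s, 'a) qtable \<Rightarrow> ('s \<Rightarrow> 'a) \<Rightarrow> bool" where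
  "greedy Q \<pi> \<longleftrightarrow> (\<forall>s. is_arg_min (Q s) (\<lambda>_. True) (\<pi> s))"

definition agreement_rate :: "('s::finite \<Rightarrow> 'a) \<Rightarrow> ('s \<Rightarrow> 'a) \<Rightarrow> real" where
  "agreement_rate \<pi> \<pi>' = 1 / real CARD('s) * (\<Sum>j\<in>UNIV. of_bool (\<pi> j = \<pi>' j))"

definition softmax :: "nat \<Rightarrow> (nat \<Rightarrow> real) \<Rightarrow> nat \<Rightarrow> real" where
  "softmax K x n = exp (x n) / (\<Sum>m = 1..K. exp (x m))"

definition esql_weight :: "nat \<Rightarrow> (nat \<Rightarrow> 's::finite \<Rightarrow> 'a) \<Rightarrow> nat \<Rightarrow> real" where
  "esql_weight K \<pi> = softmax K (\<lambda>n. agreement_rate (\<pi> 1) (\<pi> n))"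

text \<open>
  In the sequences below the environment \<open>n \<in> {1..K}\<close> is the first index and the time \<open>t\<close> the second.
\<close>

primrec esql_output ::
  "nat \<Rightarrow> (nat \<Rightarrow> real) \<Rightarrow> (nat \<Rightarrow> nat \<Rightarrow> real) \<Rightarrow> (nat \<Rightarrow> nat \<Rightarrow> ('s, 'a) qtable)
    \<Rightarrow> nat \<Rightarrow> ('s, 'a) qtable" where
  "esql_output K u w Q 0 = (\<lambda>s a. 0)"
| "esql_output K u w Q (Suc t) =
    (\<lambda>s a. u t * esql_output K u w Q t s a + (1 - u t) * (\<Sum>n = 1..K. w n t * Q n t s a))"

definition esql_run ::
  "nat \<Rightarrow> (nat \<Rightarrow> 's::finite \<Rightarrow> 'a::finite \<Rightarrow> 's pmf) \<Rightarrow> ('s, 'a) qtable \<Rightarrow> real \<Rightarrow> (nat \<Rightarrow> real)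
    \<Rightarrow> (nat \<Rightarrow> nat \<Rightarrow> ('s, 'a) qtable) \<Rightarrow> (nat \<Rightarrow> nat \<Rightarrow> real) \<Rightarrow> (nat \<Rightarrow> ('s, 'a) qtable) \<Rightarrow> bool" where
  "esql_run K P c \<gamma> u Q w Qit \<longleftrightarrow>
    (\<forall>n\<in>{1..K}. q_learning_run (P n) c \<gamma> (Q n)) \<and>
    (\<exists>\<pi>. (\<forall>n\<in>{1..K}. \<forall>t. greedy (Q n t) (\<pi> n t)) \<and>
         (\<forall>n\<in>{1..K}. \<forall>t. w n t = esql_weight K (\<lambda>m. \<pi> m t) n)) \<and>
    Qit = esql_output K u w Q"

definition output_increment :: "(nat \<Rightarrow> ('s, 'a) qtable) \<Rightarrow> nat \<Rightarrow> ('s, 'a) qtable" where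
  "output_increment Qit t s a = Qit (Suc t) s a - Qit t s a"

definition weighted_increment ::
  "(nat \<Rightarrow> real) \<Rightarrow> (nat \<Rightarrow> ('s, 'a) qtable) \<Rightarrow> nat \<Rightarrow> ('s, 'a) qtable" where
  "weighted_increment w Q t s a = w (Suc t) * Q (Suc t) s a - w t * Q t s a"

end

theory Submission
  imports Defs
begin

text \<open>
  The output increments satisfy
  \<open>\<Delta>\<^sub>t\<^sub>+\<^sub>1 = u \<Delta>\<^sub>t + (1 - u) (\<epsilon>\<^sub>t\<^sup>1 + \<dots> + \<epsilon>\<^sub>t\<^sup>K)\<close>, and each \<open>\<epsilon>\<close> is absolutely summable by
  the ratio test. Summing the recursion bounds \<open>(1 - u) (\<bar>\<Delta>\<^sub>0\<bar> + \<dots> + \<bar>\<Delta>\<^sub>T\<bar>)\<close> uniformly in \<open>T\<close>,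
  so \<open>\<Delta>\<close> is absolutely summable and in particular vanishes in the limit.
\<close>

lemma summable_norm_affine_recursion:
  fixes x b :: "nat \<Rightarrow> 'v::real_normed_vector" and u :: real
  assumes "\<bar>u\<bar> < 1"
    and rec: "\<And>t. x (Suc t) = u *\<^sub>R x t + b t"
    and b: "summable (\<lambda>t. norm (b t))"
  shows "summable (\<lambda>t. norm (x t))"
proof (rule bounded_imp_summable)
  fix T
  \<comment> \<open>The extra term is added so that, once index 0 is split off, the remaining terms
    are exactly the successors that the recursion rewrites.\<close>
  have "(\<Sum>t\<le>T. norm (x t)) \<le> (\<Sum>t\<le>Suc T. norm (x t))"
    by simp
  also have "\<dots> = norm (x 0) + (\<Sum>t\<le>T. norm (u *\<^sub>R x t + b t))"
    by (simp only: sum.atMost_Suc_shift rec)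
  also have "\<dots> \<le> norm (x 0) + (\<Sum>t\<le>T. \<bar>u\<bar> * norm (x t) + norm (b t))"
    by (intro add_left_mono sum_mono) (metis norm_scaleR norm_triangle_ineq)
  also have "\<dots> \<le> norm (x 0) + \<bar>u\<bar> * (\<Sum>t\<le>T. norm (x t)) + (\<Sum>t. norm (b t))"
    using sum_le_suminf[OF b, of "{..T}"] by (simp add: sum.distrib sum_distrib_left)
  \<comment> \<open>The partial sum up to \<open>T\<close> occurs on both sides and is absorbed on
    the left; the bound that remains is free of \<open>T\<close>.\<close>
  finally have "(1 - \<bar>u\<bar>) * (\<Sum>t\<le>T. norm (x t)) \<le> norm (x 0) + (\<Sum>t. norm (b t))"
    by (simp add: algebra_simps)
  then show "(\<Sum>t\<le>T. norm (x t)) \<le> (norm (x 0) + (\<Sum>t. norm (b t))) / (1 - \<bar>u\<bar>)"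
    using assms(1) by (simp add: field_simps)
qed simp

text \<open>Subtract two consecutive updates: as the ratio is the same at both times,
  \<open>u\<close> and \<open>1 - u\<close> factor out of the differences.\<close>

lemma output_increment_Suc:
  "output_increment (esql_output K (\<lambda>_. u) w Q) (Suc t) s a =
    u * output_increment (esql_output K (\<lambda>_. u) w Q) t s a +
    (1 - u) * (\<Sum>n = 1..K. weighted_increment (w n) (Q n) t s a)"
  by (simp add: output_increment_def weighted_increment_def sum_subtractf algebra_simps)

theorem proposition3:
  fixes K :: nat and \<gamma> u :: real
    and P :: "nat \<Rightarrow> 's::finite \<Rightarrow> 'a::finite \<Rightarrow> 's pmf"
    and c :: "('s, 'a) qtable"
    and Q :: "nat \<Rightarrow> nat \<Rightarrow> ('s, 'a) qtable"
    and w :: "nat \<Rightarrow> nat \<Rightarrow> real"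
    and Qit :: "nat \<Rightarrow> ('s, 'a) qtable"
    and \<phi> :: "nat \<Rightarrow> 's \<Rightarrow> 'a \<Rightarrow> real"
  assumes "K \<ge> 1"
    and "\<gamma> \<in> {0<..<1}"
    and "u \<in> {0<..<1}"
    and "esql_run K P c \<gamma> (\<lambda>_. u) Q w Qit"
    and "\<And>n s a. n \<in> {1..K} \<Longrightarrow> \<phi> n s a \<in> {0<..<1}"
    and "\<And>n t s a. n \<in> {1..K} \<Longrightarrow> weighted_increment (w n) (Q n) t s a \<noteq> 0"
    and "\<And>n t s a. n \<in> {1..K} \<Longrightarrow>
           \<bar>weighted_increment (w n) (Q n) (Suc t) s a\<bar> / \<bar>weighted_increment (w n) (Q n) t s a\<bar> \<le> \<phi> n s a"
  shows "\<forall>s a. (\<lambda>t. \<bar>output_increment Qit t s a\<bar>) \<longlonglongrightarrow> 0"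
proof (intro allI)
  fix s a
  let ?\<epsilon> = "\<lambda>n t. weighted_increment (w n) (Q n) t s a"
  have \<epsilon>: "summable (\<lambda>t. \<bar>?\<epsilon> n t\<bar>)" if n: "n \<in> {1..K}" for n
  proof (rule summable_ratio_test[of "\<phi> n s a" 0])
    show "\<phi> n s a < 1"
      using assms(5)[OF n, of s a] by simp
    \<comment> \<open>Division by 0 yields 0, so the ratio bound alone would say nothing after a
      vanishing increment; nonzero denominators turn it into this product form.\<close>
    show "norm \<bar>?\<epsilon> n (Suc t)\<bar> \<le> \<phi> n s a * norm \<bar>?\<epsilon> n t\<bar>" for t
      using assms(6)[OF n, of t s a] assms(7)[OF n, of t s a] by (simp add: pos_divide_le_eq)
  qed
  \<comment> \<open>This is the inhomogeneous term of the recursion for fixed \<open>s\<close> and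
    \<open>a\<close>, dominated through the triangle inequality by finitely many summable
    sequences.\<close>
  have "summable (\<lambda>t. \<bar>(1 - u) * (\<Sum>n = 1..K. ?\<epsilon> n t)\<bar>)"
  proof (rule summable_comparison_test')
    show "summable (\<lambda>t. \<bar>1 - u\<bar> * (\<Sum>n = 1..K. \<bar>?\<epsilon> n t\<bar>))"
      by (intro summable_mult summable_sum \<epsilon>)
    show "norm \<bar>(1 - u) * (\<Sum>n = 1..K. ?\<epsilon> n t)\<bar> \<le> \<bar>1 - u\<bar> * (\<Sum>n = 1..K. \<bar>?\<epsilon> n t\<bar>)" for t
      by (simp add: abs_mult mult_left_mono sum_abs)
  qed
  moreover have "Qit = esql_output K (\<lambda>_. u) w Q"
    using assms(4) by (simp add: esql_run_def)
  ultimately have "summable (\<lambda>t. \<bar>output_increment Qit t s a\<bar>)"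
    using summable_norm_affine_recursion[of u "\<lambda>t. output_increment Qit t s a"
        "\<lambda>t. (1 - u) * (\<Sum>n = 1..K. ?\<epsilon> n t)"] assms(3)
    by (simp add: output_increment_Suc)
  then show "(\<lambda>t. \<bar>output_increment Qit t s a\<bar>) \<longlonglongrightarrow> 0"
    by (rule summable_LIMSEQ_zero)
qed

end
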